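(* Let $A$ be a Banach algebra and $B$ a Banach $A$-bimodule. (1) If $A^{**}=a_0A^{**}$ [resp. $A^{**}=A^{**}a_0$] for some $a_0\in A$ and $a_0$ has the $Rw^*w$-property [resp. $Lw^*w$-property], then $Z_{B^{**}}(A^{**})=A^{**}$. (2) If $B^{**}=a_0B^{**}$ [resp. $B^{**}=B^{**}a_0$] for some $a_0\in A$ and $a_0$ has the $Rw^*w$-property [resp. $Lw^*w$-property] with respect to $B$, then $Z_{A^{**}}(B^{**})=B^{**}$.
   Context: For a bounded bilinear map $m:X\times Y\to Z$ of normed spaces, define $m^*:Z^*\times X\to Y^*$ by $\langle m^*(z',x),y\rangle=\langle z',m(x,y)\rangle$, and $m^{**}=(m^* )^*:Y^{**}\times Z^*\to X^*$, $m^{***}=(m^{**})^*:X^{**}\times Y^{**}\to Z^{**}$. Let $\pi_\ell:A\times B\to B$, $\pi_r:B\times A\to B$ be the module actions. $Z_{B^{**}}(A^{**})=\{a''\in A^{**}: b''\mapsto\pi_\ell^{***}(a'',b'')\text{ is weak}^*\text{-to-weak}^*\text{ continuous }B^{**}\to B^{**}\}$; $Z_{A^{**}}(B^{**})=\{b''\in B^{**}: a''\mapsto\pi_r^{***}(b'',a'')\text{ is weak}^*\text{-to-weak}^*\text{ continuous }A^{**}\to B^{**}\}$. $B^*$ is an $A$-bimodule via $\langle b'a,b\rangle=\langle b',ab\rangle$, $\langle ab',b\rangle=\langle b',ba\rangle$; $B^{**}$ is an $A$-bimodule via $\langle ab'',b'\rangle=\langle b'',b'a\rangle$, $\langle b''a,b'\rangle=\langle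 b'',ab'\rangle$. The same formulas with $B=A$ (multiplication as actions) give the actions of $A$ on $A^*$ and $A^{**}$. $a\in A$ has the $Lw^*w$-property (left-weak$^*$-to-weak property) with respect to $B$ if for every net $(b'_\alpha)_\alpha\subseteq B^*$, $ab'_\alpha\to0$ weak$^*$ implies $ab'_\alpha\to0$ weakly. $a$ has the $Rw^*w$-property with respect to $B$ if for every net $(b'_\alpha)_\alpha\subseteq B^*$, $b'_\alpha a\to0$ weak$^*$ implies $b'_\alpha a\to0$ weakly. Without mention of $B$, the properties are taken with respect to the bimodule $A$ itself. *)

theory Defs
  imports "HOL-Analysis.Analysis"
begin

section \<open>Banach algebras and Banach bimodules over the real or complex numbers\<close>

text \<open>
  The scalar field is a type \<open>'k\<close> of class \<open>real_normed_field\<close>; by the Gelfand--Mazur theorem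
  this means the reals or the complex numbers. The type classes provide the norm, completeness
  and the underlying real vector space; the locale adds scalar multiplication by \<open>'k\<close>.
\<close>

locale normed_space_over = vector_space smul
  for smul :: "'k::real_normed_field \<Rightarrow> 'v::real_normed_vector \<Rightarrow> 'v" +
  assumes norm_scale: "norm (smul c x) = norm c * norm x"
    and scale_of_real: "smul (of_real r) x = r *\<^sub>R x"

locale banach_algebra_over = normed_space_over smul
  for smul :: "'k::real_normed_field \<Rightarrow> 'a::{real_normed_algebra,banach} \<Rightarrow> 'a" +
  assumes scale_mult_left: "smul c x * y = smul c (x * y)"
    and scale_mult_right: "x * smul c y = smul c (x * y)"

text \<open>The left action is \<open>lact a b = ab\<close>, the right action is \<open>ract b a = ba\<close>.\<close>

locale banach_bimodule_over =
  A: banach_algebra_over scaleA + B: normed_space_over scaleB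
  for scaleA :: "'k::real_normed_field \<Rightarrow> 'a::{real_normed_algebra,banach} \<Rightarrow> 'a"
    and scaleB :: "'k \<Rightarrow> 'b::banach \<Rightarrow> 'b" +
  fixes lact :: "'a \<Rightarrow> 'b \<Rightarrow> 'b"
    and ract :: "'b \<Rightarrow> 'a \<Rightarrow> 'b"
  assumes bounded_bilinear_lact: "bounded_bilinear lact"
    and lact_scaleA: "lact (scaleA c a) b = scaleB c (lact a b)"
    and lact_scaleB: "lact a (scaleB c b) = scaleB c (lact a b)"
    and bounded_bilinear_ract: "bounded_bilinear ract"
    and ract_scaleA: "ract b (scaleA c a) = scaleB c (ract b a)"
    and ract_scaleB: "ract (scaleB c b) a = scaleB c (ract b a)"
    and lact_mult: "lact (a * a') b = lact a (lact a' b)"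
    and ract_mult: "ract b (a * a') = ract (ract b a) a'"
    and lact_ract: "lact a (ract b a') = ract (lact a b) a'"

section \<open>First and second duals\<close>

definition dual :: "('k::real_normed_field \<Rightarrow> 'v::real_normed_vector \<Rightarrow> 'v) \<Rightarrow> ('v \<Rightarrow> 'k) set"
  where "dual smul = {f. bounded_linear f \<and> (\<forall>c x. f (smul c x) = c * f x)}"

text \<open>
  An element of the second dual is a function on the set \<open>dual smul\<close>, hence it is normalised to
  be \<open>undefined\<close> outside that set. The norm of the dual space is the operator norm \<open>onorm\<close>.
\<close>

definition bidual ::
    "('k::real_normed_field \<Rightarrow> 'v::real_normed_vector \<Rightarrow> 'v) \<Rightarrow> (('v \<Rightarrow> 'k) \<Rightarrow> 'k) set"
  where "bidual smul = {\<Phi> \<in> extensional (dual smul).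
    (\<forall>f\<in>dual smul. \<forall>g\<in>dual smul. \<Phi> (\<lambda>x. f x + g x) = \<Phi> f + \<Phi> g) \<and>
    (\<forall>c. \<forall>f\<in>dual smul. \<Phi> (\<lambda>x. c * f x) = c * \<Phi> f) \<and>
    (\<exists>C. \<forall>f\<in>dual smul. norm (\<Phi> f) \<le> C * onorm f)}"

text \<open>The weak* topologies are the topologies of pointwise convergence.\<close>

definition weak_star_dual ::
    "('k::real_normed_field \<Rightarrow> 'v::real_normed_vector \<Rightarrow> 'v) \<Rightarrow> ('v \<Rightarrow> 'k) topology"
  where "weak_star_dual smul =
    subtopology (product_topology (\<lambda>_. euclidean) UNIV) (dual smul)"

definition weak_star_bidual ::
    "('k::real_normed_field \<Rightarrow> 'v::real_normed_vector \<Rightarrow> 'v) \<Rightarrow> (('v \<Rightarrow> 'k) \<Rightarrow> 'k) topology"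
  where "weak_star_bidual smul =
    subtopology (product_topology (\<lambda>_. euclidean) (dual smul)) (bidual smul)"

text \<open>The weak topology of the dual is the initial topology for the elements of the second dual.\<close>

definition weak_dual ::
    "('k::real_normed_field \<Rightarrow> 'v::real_normed_vector \<Rightarrow> 'v) \<Rightarrow> ('v \<Rightarrow> 'k) topology"
  where "weak_dual smul =
    pullback_topology (dual smul) (\<lambda>f. \<lambda>\<Phi>\<in>bidual smul. \<Phi> f)
      (product_topology (\<lambda>_. euclidean) (bidual smul))"

section \<open>Adjoints of bilinear maps\<close>

text \<open>
  For \<open>m : X \<times> Y \<rightarrow> Z\<close> this is \<open>m\<^sup>* : Z\<^sup>* \<times> X \<rightarrow> Y\<^sup>*\<close>; the set \<open>Y\<close> is the domain of the resulting
  functionals (\<open>UNIV\<close> if the space is a whole type).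
\<close>

definition bilinear_adjoint :: "'y set \<Rightarrow> ('x \<Rightarrow> 'y \<Rightarrow> 'z) \<Rightarrow> ('z \<Rightarrow> 'k) \<Rightarrow> 'x \<Rightarrow> ('y \<Rightarrow> 'k)"
  where "bilinear_adjoint Y m z' x = (\<lambda>y\<in>Y. z' (m x y))"

text \<open>
  For \<open>m : X \<times> Y \<rightarrow> Z\<close> on whole types, the second arguments of \<open>m\<close>, \<open>m\<^sup>*\<close>, \<open>m\<^sup>*\<^sup>*\<close> range over
  \<open>Y\<close>, \<open>X\<close> and \<open>Z\<^sup>*\<close> respectively.
\<close>

definition triple_adjoint ::
    "('k::real_normed_field \<Rightarrow> 'z::real_normed_vector \<Rightarrow> 'z) \<Rightarrow> ('x \<Rightarrow> 'y \<Rightarrow> 'z) \<Rightarrow>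
      (('x \<Rightarrow> 'k) \<Rightarrow> 'k) \<Rightarrow> (('y \<Rightarrow> 'k) \<Rightarrow> 'k) \<Rightarrow> (('z \<Rightarrow> 'k) \<Rightarrow> 'k)"
  where "triple_adjoint scaleZ m = bilinear_adjoint (dual scaleZ) (bilinear_adjoint UNIV (bilinear_adjoint UNIV m))"

section \<open>Topological centres\<close>

text \<open>\<open>Z\<close> of \<open>A\<^sup>*\<^sup>*\<close> with respect to \<open>B\<^sup>*\<^sup>*\<close>\<close>

definition left_centre ::
    "('k::real_normed_field \<Rightarrow> 'a::real_normed_vector \<Rightarrow> 'a) \<Rightarrow>
     ('k \<Rightarrow> 'b::real_normed_vector \<Rightarrow> 'b) \<Rightarrow> ('a \<Rightarrow> 'b \<Rightarrow> 'b) \<Rightarrow> (('a \<Rightarrow> 'k) \<Rightarrow> 'k) set"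
  where "left_centre scaleA scaleB lact = {a'' \<in> bidual scaleA.
    continuous_map (weak_star_bidual scaleB) (weak_star_bidual scaleB)
      (\<lambda>b''. triple_adjoint scaleB lact a'' b'')}"

text \<open>\<open>Z\<close> of \<open>B\<^sup>*\<^sup>*\<close> with respect to \<open>A\<^sup>*\<^sup>*\<close>\<close>

definition right_centre ::
    "('k::real_normed_field \<Rightarrow> 'a::real_normed_vector \<Rightarrow> 'a) \<Rightarrow>
     ('k \<Rightarrow> 'b::real_normed_vector \<Rightarrow> 'b) \<Rightarrow> ('b \<Rightarrow> 'a \<Rightarrow> 'b) \<Rightarrow> (('b \<Rightarrow> 'k) \<Rightarrow> 'k) set"
  where "right_centre scaleA scaleB ract = {b'' \<in> bidual scaleB.
    continuous_map (weak_star_bidual scaleA) (weak_star_bidual scaleB)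
      (\<lambda>a''. triple_adjoint scaleB ract b'' a'')}"

section \<open>Actions on the duals\<close>

text \<open>\<open>b'a\<close> and \<open>ab'\<close>; note that the right action on the dual comes from the left action on the
  module, and conversely.\<close>

definition dual_ract :: "('a \<Rightarrow> 'b \<Rightarrow> 'b) \<Rightarrow> ('b \<Rightarrow> 'k) \<Rightarrow> 'a \<Rightarrow> ('b \<Rightarrow> 'k)"
  where "dual_ract lact b' a = (\<lambda>b. b' (lact a b))"

definition dual_lact :: "('b \<Rightarrow> 'a \<Rightarrow> 'b) \<Rightarrow> 'a \<Rightarrow> ('b \<Rightarrow> 'k) \<Rightarrow> ('b \<Rightarrow> 'k)"
  where "dual_lact ract a b' = (\<lambda>b. b' (ract b a))"

definition bidual_lact ::
    "('k::real_normed_field \<Rightarrow> 'b::real_normed_vector \<Rightarrow> 'b) \<Rightarrow> ('a \<Rightarrow> 'b \<Rightarrow> 'b) \<Rightarrow>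
     'a \<Rightarrow> (('b \<Rightarrow> 'k) \<Rightarrow> 'k) \<Rightarrow> (('b \<Rightarrow> 'k) \<Rightarrow> 'k)"
  where "bidual_lact scaleB lact a b'' = (\<lambda>b'\<in>dual scaleB. b'' (dual_ract lact b' a))"

definition bidual_ract ::
    "('k::real_normed_field \<Rightarrow> 'b::real_normed_vector \<Rightarrow> 'b) \<Rightarrow> ('b \<Rightarrow> 'a \<Rightarrow> 'b) \<Rightarrow>
     (('b \<Rightarrow> 'k) \<Rightarrow> 'k) \<Rightarrow> 'a \<Rightarrow> (('b \<Rightarrow> 'k) \<Rightarrow> 'k)"
  where "bidual_ract scaleB ract b'' a = (\<lambda>b'\<in>dual scaleB. b'' (dual_lact ract a b'))"

section \<open>The weak*-to-weak properties\<close>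

text \<open>
  Nets in \<open>B\<^sup>*\<close> are represented by filters on \<open>B\<^sup>*\<close>: a net yields the filter of the sets that
  eventually contain it, and a filter \<open>F\<close> arises from the net \<open>(f, S) \<mapsto> f\<close> indexed by the pairs
  with \<open>f \<in> S \<in> F\<close>. The lemmas below give the properties for families over any index type.
\<close>

definition Lww_property ::
    "('k::real_normed_field \<Rightarrow> 'b::real_normed_vector \<Rightarrow> 'b) \<Rightarrow> ('b \<Rightarrow> 'a \<Rightarrow> 'b) \<Rightarrow> 'a \<Rightarrow> bool"
  where "Lww_property scaleB ract a \<longleftrightarrow>
    (\<forall>F. (\<forall>\<^sub>F b' in F. b' \<in> dual scaleB) \<longrightarrow>
      limitin (weak_star_dual scaleB) (\<lambda>b'. dual_lact ract a b') (\<lambda>_. 0) F \<longrightarrow>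
      limitin (weak_dual scaleB) (\<lambda>b'. dual_lact ract a b') (\<lambda>_. 0) F)"

definition Rww_property ::
    "('k::real_normed_field \<Rightarrow> 'b::real_normed_vector \<Rightarrow> 'b) \<Rightarrow> ('a \<Rightarrow> 'b \<Rightarrow> 'b) \<Rightarrow> 'a \<Rightarrow> bool"
  where "Rww_property scaleB lact a \<longleftrightarrow>
    (\<forall>F. (\<forall>\<^sub>F b' in F. b' \<in> dual scaleB) \<longrightarrow>
      limitin (weak_star_dual scaleB) (\<lambda>b'. dual_ract lact b' a) (\<lambda>_. 0) F \<longrightarrow>
      limitin (weak_dual scaleB) (\<lambda>b'. dual_ract lact b' a) (\<lambda>_. 0) F)"

lemma Lww_property_net:
  assumes "Lww_property scaleB ract a" and "\<forall>\<^sub>F i in G. b' i \<in> dual scaleB"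
    and "limitin (weak_star_dual scaleB) (\<lambda>i. dual_lact ract a (b' i)) (\<lambda>_. 0) G"
  shows "limitin (weak_dual scaleB) (\<lambda>i. dual_lact ract a (b' i)) (\<lambda>_. 0) G"
  using assms(1)[unfolded Lww_property_def, rule_format, of "filtermap b' G"] assms(2,3)
  by (simp add: limitin_def eventually_filtermap)

lemma Rww_property_net:
  assumes "Rww_property scaleB lact a" and "\<forall>\<^sub>F i in G. b' i \<in> dual scaleB"
    and "limitin (weak_star_dual scaleB) (\<lambda>i. dual_ract lact (b' i) a) (\<lambda>_. 0) G"
  shows "limitin (weak_dual scaleB) (\<lambda>i. dual_ract lact (b' i) a) (\<lambda>_. 0) G"
  using assms(1)[unfolded Rww_property_def, rule_format, of "filtermap b' G"] assms(2,3)
  by (simp add: limitin_def eventually_filtermap)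

end

theory Submission
  imports Defs
begin

text \<open>
  All four claims are instances of one statement about a bounded bilinear map
  \<open>m : X \<times> Y \<rightarrow> Z\<close> and a linear map \<open>T : X \<rightarrow> X\<close> whose second adjoint maps \<open>X\<^sup>*\<^sup>*\<close> onto itself and
  for which \<open>x'\<^sub>\<alpha> \<circ> T \<rightarrow> 0\<close> weak* implies \<open>x'\<^sub>\<alpha> \<circ> T \<rightarrow> 0\<close> weakly: then every
  \<open>y'' \<mapsto> m\<^sup>*\<^sup>*\<^sup>*(x'', y'')\<close> with \<open>x'' \<in> X\<^sup>*\<^sup>*\<close> is weak*-to-weak* continuous. One takes \<open>m\<close> to be the left action
  (\<open>X = A\<close>) or the right action (\<open>X = B\<close>), and \<open>T\<close> to be left or right multiplication by \<open>a\<^sub>0\<close>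
  on \<open>X\<close>.

  The reason is the following. By definition
  \<open>\<langle>m\<^sup>*\<^sup>*\<^sup>*(x'', y''), z'\<rangle> = \<langle>x'', m\<^sup>*\<^sup>*(y'', z')\<rangle>\<close>, and \<open>y'' \<mapsto> m\<^sup>*\<^sup>*(y'', z')\<close> is always weak*-to-weak*
  continuous into \<open>X\<^sup>*\<close>, because \<open>\<langle>m\<^sup>*\<^sup>*(y'', z'), x\<rangle>\<close> is the value of \<open>y''\<close> at a fixed element of
  \<open>Y\<^sup>*\<close>. What may fail is the continuity of \<open>x''\<close> for the weak* topology of \<open>X\<^sup>*\<close>. But \<open>x''\<close> has the
  form \<open>u \<circ> T\<^sup>*\<close> with \<open>u \<in> X\<^sup>*\<^sup>*\<close>; the assumption on \<open>T\<close> upgrades the weak* convergence of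
  \<open>m\<^sup>*\<^sup>*(y'', z') \<circ> T\<close> to weak convergence, which \<open>u\<close> respects. This is
  \<open>triple_adjoint_continuous\<close>; the lemmas before it supply the boundedness and linearity
  that place the successive adjoints in the respective dual spaces.
\<close>

section \<open>First and second duals\<close>

lemma dualD:
  assumes "f \<in> dual smul"
  shows "bounded_linear f" "f (smul c x) = c * f x" "f (x + y) = f x + f y"
    "norm (f x) \<le> onorm f * norm x" "0 \<le> onorm f"
  using assms by (auto simp: dual_def linear_simps onorm onorm_pos_le)

lemma zero_in_dual: "(\<lambda>_. 0) \<in> dual smul"
  by (simp add: dual_def)

lemma diff_in_dual:
  assumes "f \<in> dual smul" "g \<in> dual smul"
  shows "(\<lambda>x. f x - g x) \<in> dual smul"
  using assms by (auto simp: dual_def bounded_linear_sub algebra_simps)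

lemma bidualD:
  assumes "\<Phi> \<in> bidual smul" "f \<in> dual smul" "g \<in> dual smul"
  shows "\<Phi> (\<lambda>x. f x + g x) = \<Phi> f + \<Phi> g" "\<Phi> (\<lambda>x. c * f x) = c * \<Phi> f"
  using assms by (auto simp: bidual_def)

lemma bidual_zero:
  assumes "\<Phi> \<in> bidual smul"
  shows "\<Phi> (\<lambda>_. 0) = 0"
  using bidualD(2)[OF assms zero_in_dual zero_in_dual, of 0] by simp

lemma bidual_diff:
  assumes "\<Phi> \<in> bidual smul" "f \<in> dual smul" "g \<in> dual smul"
  shows "\<Phi> (\<lambda>x. f x - g x) = \<Phi> f - \<Phi> g"
  using bidualD(1)[OF assms(1) diff_in_dual[OF assms(2,3)] assms(3)] by simp

lemma bidual_bound:
  assumes "\<Phi> \<in> bidual smul"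
  obtains C where "0 \<le> C" "\<And>f. f \<in> dual smul \<Longrightarrow> norm (\<Phi> f) \<le> C * onorm f"
proof -
  obtain C where C: "\<And>f. f \<in> dual smul \<Longrightarrow> norm (\<Phi> f) \<le> C * onorm f"
    using assms unfolding bidual_def by blast
  have "norm (\<Phi> f) \<le> max C 0 * onorm f" if "f \<in> dual smul" for f
    using C[OF that] mult_right_mono[OF max.cobounded1[of C 0] dualD(5)[OF that]] by linarith
  then show thesis by (intro that[of "max C 0"]) auto
qed

section \<open>Convergence in the weak and weak* topologies\<close>

lemma topspace_weak_star_bidual: "topspace (weak_star_bidual smul) = bidual smul"
  by (auto simp: weak_star_bidual_def bidual_def PiE_def)

lemma limitin_weak_star_dual:
  "limitin (weak_star_dual smul) h l F \<longleftrightarrow>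
    l \<in> dual smul \<and> (\<forall>\<^sub>F i in F. h i \<in> dual smul) \<and> (\<forall>x. ((\<lambda>i. h i x) \<longlongrightarrow> l x) F)"
  by (auto simp: weak_star_dual_def limitin_subtopology limitin_componentwise)

lemma limitin_weak_dualD:
  assumes "limitin (weak_dual smul) h l F" "\<Phi> \<in> bidual smul"
  shows "((\<lambda>i. \<Phi> (h i)) \<longlongrightarrow> \<Phi> l) F"
proof -
  have "continuous_map (weak_dual smul) euclidean
      ((\<lambda>w. w \<Phi>) \<circ> (\<lambda>f. \<lambda>\<Phi>\<in>bidual smul. \<Phi> f))"
    unfolding weak_dual_def
    by (intro continuous_map_pullback continuous_map_product_projection assms(2))
  then have "continuous_map (weak_dual smul) euclidean (\<lambda>f. \<Phi> f)"
    using assms(2) by (simp add: o_def)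
  from continuous_map_limit[OF this assms(1)] show ?thesis
    by (simp add: o_def)
qed

text \<open>
  The common form of the \<open>Lw\<^sup>*w\<close>- and \<open>Rw\<^sup>*w\<close>-properties: they are statements about the adjoint of
  the multiplication operator \<open>T\<close>.
\<close>

definition adjoint_weak_star_to_weak ::
    "('k::real_normed_field \<Rightarrow> 'v::real_normed_vector \<Rightarrow> 'v) \<Rightarrow> ('v \<Rightarrow> 'v) \<Rightarrow> bool"
  where "adjoint_weak_star_to_weak smul T \<longleftrightarrow>
    (\<forall>F. (\<forall>\<^sub>F f in F. f \<in> dual smul) \<longrightarrow>
      limitin (weak_star_dual smul) (\<lambda>f x. f (T x)) (\<lambda>_. 0) F \<longrightarrow>
      limitin (weak_dual smul) (\<lambda>f x. f (T x)) (\<lambda>_. 0) F)"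

lemma Lww_property_adjoint:
  "Lww_property smul ract a \<longleftrightarrow> adjoint_weak_star_to_weak smul (\<lambda>b. ract b a)"
  by (simp add: Lww_property_def adjoint_weak_star_to_weak_def dual_lact_def)

lemma Rww_property_adjoint:
  "Rww_property smul lact a \<longleftrightarrow> adjoint_weak_star_to_weak smul (lact a)"
  by (simp add: Rww_property_def adjoint_weak_star_to_weak_def dual_ract_def)

text \<open>
  The filter on the dual that the property is applied to is the image of \<open>G\<close> under \<open>h\<close>, so that
  it covers families over any index type.
\<close>

lemma adjoint_weak_star_to_weakD:
  assumes "adjoint_weak_star_to_weak smul T" "\<forall>\<^sub>F i in G. h i \<in> dual smul"
    and "limitin (weak_star_dual smul) (\<lambda>i x. h i (T x)) (\<lambda>_. 0) G"
  shows "limitin (weak_dual smul) (\<lambda>i x. h i (T x)) (\<lambda>_. 0) G"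
  using assms(1)[unfolded adjoint_weak_star_to_weak_def, rule_format, of "filtermap h G"]
    assms(2,3)
  by (simp add: limitin_def eventually_filtermap)

section \<open>The triple adjoint of a bounded bilinear map\<close>

locale bounded_bilinear_over =
  X: normed_space_over scaleX + Y: normed_space_over scaleY + Z: normed_space_over scaleZ
  for scaleX :: "'k::real_normed_field \<Rightarrow> 'x::real_normed_vector \<Rightarrow> 'x"
    and scaleY :: "'k \<Rightarrow> 'y::real_normed_vector \<Rightarrow> 'y"
    and scaleZ :: "'k \<Rightarrow> 'z::real_normed_vector \<Rightarrow> 'z" +
  fixes m :: "'x \<Rightarrow> 'y \<Rightarrow> 'z"
  assumes bounded: "bounded_bilinear m"
    and scale_left: "m (scaleX c x) y = scaleZ c (m x y)"
    and scale_right: "m x (scaleY c y) = scaleZ c (m x y)"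
begin

interpretation m: bounded_bilinear m
  by (rule bounded)

text \<open>
  These are \<open>m\<^sup>*\<close> and \<open>m\<^sup>*\<^sup>*\<close>, written without the vacuous restriction to \<open>UNIV\<close>.
\<close>

definition adj1 :: "('z \<Rightarrow> 'k) \<Rightarrow> 'x \<Rightarrow> 'y \<Rightarrow> 'k"
  where "adj1 z' x = (\<lambda>y. z' (m x y))"

definition adj2 :: "(('y \<Rightarrow> 'k) \<Rightarrow> 'k) \<Rightarrow> ('z \<Rightarrow> 'k) \<Rightarrow> 'x \<Rightarrow> 'k"
  where "adj2 y'' z' = (\<lambda>x. y'' (adj1 z' x))"

lemma triple_adjoint_eq:
  "triple_adjoint scaleZ m x'' y'' = (\<lambda>z'\<in>dual scaleZ. x'' (adj2 y'' z'))"
  by (simp add: triple_adjoint_def bilinear_adjoint_def adj1_def adj2_def fun_eq_iff restrict_UNIV)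

lemma adj1_in_dual:
  assumes "z' \<in> dual scaleZ"
  shows "adj1 z' x \<in> dual scaleY"
  using bounded_linear_compose[OF dualD(1)[OF assms] m.bounded_linear_right, of x]
  by (simp add: dual_def adj1_def scale_right dualD(2)[OF assms])

lemma onorm_adj1_bound:
  obtains K where "0 \<le> K"
    "\<And>z' x. z' \<in> dual scaleZ \<Longrightarrow> onorm (adj1 z' x) \<le> K * onorm z' * norm x"
proof -
  obtain K where K: "0 \<le> K" "\<And>x y. norm (m x y) \<le> norm x * norm y * K"
    using m.nonneg_bounded by blast
  have "onorm (adj1 z' x) \<le> K * onorm z' * norm x" if z': "z' \<in> dual scaleZ" for z' x
  proof (rule onorm_bound)
    show "0 \<le> K * onorm z' * norm x"
      using K(1) dualD(5)[OF z'] by simp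
    fix y
    have "norm (adj1 z' x y) \<le> onorm z' * norm (m x y)"
      unfolding adj1_def by (rule dualD(4)[OF z'])
    also have "\<dots> \<le> onorm z' * (norm x * norm y * K)"
      by (intro mult_left_mono K(2) dualD(5)[OF z'])
    finally show "norm (adj1 z' x y) \<le> K * onorm z' * norm x * norm y"
      by (simp add: mult_ac)
  qed
  with K(1) show thesis by (rule that)
qed

text \<open>
  The constant depends on \<open>y''\<close> but not on \<open>z'\<close>: the bound in \<open>x\<close> puts \<open>m\<^sup>*\<^sup>*(y'', z')\<close> into \<open>X\<^sup>*\<close>,
  and its uniformity in \<open>z'\<close> puts \<open>m\<^sup>*\<^sup>*\<^sup>*(x'', y'')\<close> into \<open>Z\<^sup>*\<^sup>*\<close>.
\<close>

lemma adj2_bound: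
  assumes "y'' \<in> bidual scaleY"
  obtains C where "0 \<le> C"
    "\<And>z' x. z' \<in> dual scaleZ \<Longrightarrow> norm (adj2 y'' z' x) \<le> C * onorm z' * norm x"
proof -
  obtain K where K: "0 \<le> K"
    "\<And>z' x. z' \<in> dual scaleZ \<Longrightarrow> onorm (adj1 z' x) \<le> K * onorm z' * norm x"
    by (rule onorm_adj1_bound) blast
  obtain D where D: "0 \<le> D" "\<And>f. f \<in> dual scaleY \<Longrightarrow> norm (y'' f) \<le> D * onorm f"
    by (rule bidual_bound[OF assms]) blast
  have "norm (adj2 y'' z' x) \<le> (D * K) * onorm z' * norm x" if z': "z' \<in> dual scaleZ" for z' x
    using D(2)[OF adj1_in_dual[OF z'], of x] mult_left_mono[OF K(2)[OF z', of x] D(1)]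
    by (simp add: adj2_def mult.assoc)
  moreover have "0 \<le> D * K"
    using D(1) K(1) by simp
  ultimately show thesis using that by blast
qed

lemma adj2_in_dual:
  assumes y'': "y'' \<in> bidual scaleY" and z': "z' \<in> dual scaleZ"
  shows "adj2 y'' z' \<in> dual scaleX"
proof -
  have add: "adj2 y'' z' (x + x') = adj2 y'' z' x + adj2 y'' z' x'" for x x'
    using bidualD(1)[OF y'' adj1_in_dual[OF z', of x] adj1_in_dual[OF z', of x']]
    by (simp add: adj2_def adj1_def m.add_left dualD(3)[OF z'])
  have scale: "adj2 y'' z' (scaleX c x) = c * adj2 y'' z' x" for c x
    using bidualD(2)[OF y'' adj1_in_dual[OF z', of x] adj1_in_dual[OF z', of x], of c]
    by (simp add: adj2_def adj1_def scale_left dualD(2)[OF z'])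
  obtain C where C: "\<And>x. norm (adj2 y'' z' x) \<le> C * onorm z' * norm x"
    by (rule adj2_bound[OF y'']) (use z' in blast)
  have "bounded_linear (adj2 y'' z')"
  proof (rule bounded_linear_intro[of _ "C * onorm z'"])
    show "adj2 y'' z' (r *\<^sub>R x) = r *\<^sub>R adj2 y'' z' x" for r x
      using scale[of "of_real r" x] by (simp add: X.scale_of_real scaleR_conv_of_real)
    show "norm (adj2 y'' z' x) \<le> norm x * (C * onorm z')" for x
      using C[of x] by (simp add: mult_ac)
  qed (rule add)
  with scale show ?thesis by (simp add: dual_def)
qed

lemma triple_adjoint_in_bidual:
  assumes x'': "x'' \<in> bidual scaleX" and y'': "y'' \<in> bidual scaleY"
  shows "triple_adjoint scaleZ m x'' y'' \<in> bidual scaleZ"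
proof -
  let ?t = "triple_adjoint scaleZ m x'' y''"
  have add_dual: "(\<lambda>x. f x + g x) \<in> dual scaleZ"
    if "f \<in> dual scaleZ" "g \<in> dual scaleZ" for f g :: "'z \<Rightarrow> 'k"
    using that by (auto simp: dual_def bounded_linear_add algebra_simps)
  have scale_dual: "(\<lambda>x. c * f x) \<in> dual scaleZ" if "f \<in> dual scaleZ" for c and f :: "'z \<Rightarrow> 'k"
    using that by (auto simp: dual_def bounded_linear_const_mult)
  have "?t (\<lambda>x. f x + g x) = ?t f + ?t g" if f: "f \<in> dual scaleZ" and g: "g \<in> dual scaleZ" for f g
  proof -
    have "adj2 y'' (\<lambda>x. f x + g x) = (\<lambda>x. adj2 y'' f x + adj2 y'' g x)"
      using bidualD(1)[OF y'' adj1_in_dual[OF f] adj1_in_dual[OF g]]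
      by (simp add: adj2_def adj1_def)
    then show ?thesis
      using bidualD(1)[OF x'' adj2_in_dual[OF y'' f] adj2_in_dual[OF y'' g]] add_dual f g
      by (simp add: triple_adjoint_eq)
  qed
  moreover have "?t (\<lambda>x. c * f x) = c * ?t f" if f: "f \<in> dual scaleZ" for c f
  proof -
    have "adj2 y'' (\<lambda>x. c * f x) = (\<lambda>x. c * adj2 y'' f x)"
      using bidualD(2)[OF y'' adj1_in_dual[OF f] adj1_in_dual[OF f]]
      by (simp add: adj2_def adj1_def)
    then show ?thesis
      using bidualD(2)[OF x'' adj2_in_dual[OF y'' f] adj2_in_dual[OF y'' f]] scale_dual f
      by (simp add: triple_adjoint_eq)
  qed
  moreover have "\<exists>C. \<forall>f\<in>dual scaleZ. norm (?t f) \<le> C * onorm f"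
  proof -
    obtain C where C: "0 \<le> C"
      "\<And>z' x. z' \<in> dual scaleZ \<Longrightarrow> norm (adj2 y'' z' x) \<le> C * onorm z' * norm x"
      by (rule adj2_bound[OF y'']) blast
    obtain D where D: "0 \<le> D" "\<And>f. f \<in> dual scaleX \<Longrightarrow> norm (x'' f) \<le> D * onorm f"
      by (rule bidual_bound[OF x'']) blast
    have "norm (?t f) \<le> D * C * onorm f" if f: "f \<in> dual scaleZ" for f
    proof -
      have "onorm (adj2 y'' f) \<le> C * onorm f"
        by (rule onorm_bound) (use C f dualD(5)[OF f] in auto)
      then show ?thesis
        using D(2)[OF adj2_in_dual[OF y'' f]] mult_left_mono[OF _ D(1)] f
        by (fastforce simp: triple_adjoint_eq mult.assoc)
    qed
    then show ?thesis by blast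
  qed
  ultimately show ?thesis
    by (auto simp: bidual_def triple_adjoint_eq)
qed

text \<open>
  The weak*-to-weak assumption on \<open>T\<close> concerns convergence to \<open>0\<close> only, hence it is applied to the
  differences \<open>m\<^sup>*\<^sup>*(y'', z') - m\<^sup>*\<^sup>*(y\<^sub>0, z')\<close> as \<open>y''\<close> approaches \<open>y\<^sub>0\<close>. Linearity of \<open>u\<close> then turns the
  limit back into one for \<open>x'' = u \<circ> T\<^sup>*\<close>.
\<close>

theorem triple_adjoint_continuous:
  assumes surj: "bidual scaleX = (\<lambda>u. \<lambda>f\<in>dual scaleX. u (\<lambda>x. f (T x))) ` bidual scaleX"
    and T: "bounded_linear T" "\<And>c x. T (scaleX c x) = scaleX c (T x)"
    and weak: "adjoint_weak_star_to_weak scaleX T"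
    and x'': "x'' \<in> bidual scaleX"
  shows "continuous_map (weak_star_bidual scaleY) (weak_star_bidual scaleZ)
    (triple_adjoint scaleZ m x'')"
proof -
  obtain u where u: "u \<in> bidual scaleX"
    and x''_eq: "\<And>f. f \<in> dual scaleX \<Longrightarrow> x'' f = u (\<lambda>x. f (T x))"
    using x'' by (subst (asm) surj) auto
  have T_dual: "(\<lambda>x. f (T x)) \<in> dual scaleX" if "f \<in> dual scaleX" for f :: "'x \<Rightarrow> 'k"
    using bounded_linear_compose[OF dualD(1)[OF that] T(1)]
    by (simp add: dual_def T(2) dualD(2)[OF that])
  let ?W = "weak_star_bidual scaleY"
  have "continuous_map ?W euclidean (\<lambda>y''. x'' (adj2 y'' z'))" if z': "z' \<in> dual scaleZ" for z'
    unfolding continuous_map_atin topspace_weak_star_bidual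
  proof
    fix y0 assume y0: "y0 \<in> bidual scaleY"
    let ?G = "atin ?W y0"
    define h where "h = (\<lambda>y'' x. adj2 y'' z' x - adj2 y0 z' x)"
    have ev: "\<forall>\<^sub>F y'' in ?G. y'' \<in> bidual scaleY"
      using y0 by (auto simp: eventually_atin topspace_weak_star_bidual
          intro!: exI[of _ "topspace ?W"])
    have h_dual: "\<forall>\<^sub>F y'' in ?G. h y'' \<in> dual scaleX"
      using ev by eventually_elim (simp add: h_def diff_in_dual adj2_in_dual z' y0)
    have "((\<lambda>y''. h y'' (T x)) \<longlongrightarrow> 0) ?G" for x
    proof -
      have "continuous_map ?W euclidean (\<lambda>y''. y'' (adj1 z' (T x)))"
        unfolding weak_star_bidual_def
        by (intro continuous_map_from_subtopology continuous_map_product_projection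
            adj1_in_dual z')
      then have "((\<lambda>y''. y'' (adj1 z' (T x))) \<longlongrightarrow> y0 (adj1 z' (T x))) ?G"
        using y0 by (simp add: continuous_map_atin topspace_weak_star_bidual)
      then show ?thesis
        unfolding h_def adj2_def by (rule LIM_zero)
    qed
    moreover have "\<forall>\<^sub>F y'' in ?G. (\<lambda>x. h y'' (T x)) \<in> dual scaleX"
      using h_dual by eventually_elim (rule T_dual)
    ultimately have "limitin (weak_star_dual scaleX) (\<lambda>y'' x. h y'' (T x)) (\<lambda>_. 0) ?G"
      by (simp add: limitin_weak_star_dual zero_in_dual)
    from limitin_weak_dualD[OF adjoint_weak_star_to_weakD[OF weak h_dual this] u]
    have "((\<lambda>y''. u (\<lambda>x. h y'' (T x))) \<longlongrightarrow> 0) ?G"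
      by (simp add: bidual_zero[OF u])
    moreover have "\<forall>\<^sub>F y'' in ?G.
        u (\<lambda>x. h y'' (T x)) = x'' (adj2 y'' z') - x'' (adj2 y0 z')"
      using ev by eventually_elim
        (simp add: h_def bidual_diff[OF u] T_dual adj2_in_dual z' y0 x''_eq)
    ultimately have "((\<lambda>y''. x'' (adj2 y'' z') - x'' (adj2 y0 z')) \<longlongrightarrow> 0) ?G"
      by (rule Lim_transform_eventually)
    then show "limitin euclidean (\<lambda>y''. x'' (adj2 y'' z')) (x'' (adj2 y0 z')) ?G"
      by (simp add: LIM_zero_cancel)
  qed
  then have "continuous_map ?W (product_topology (\<lambda>_. euclidean) (dual scaleZ))
      (triple_adjoint scaleZ m x'')"
    by (auto simp: continuous_map_componentwise triple_adjoint_eq)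
  moreover have "triple_adjoint scaleZ m x'' \<in> topspace ?W \<rightarrow> bidual scaleZ"
    using triple_adjoint_in_bidual[OF x''] by (simp add: topspace_weak_star_bidual)
  ultimately show ?thesis
    unfolding weak_star_bidual_def[of scaleZ] by (simp add: continuous_map_in_subtopology)
qed

end

section \<open>The topological centres\<close>

lemma (in banach_bimodule_over) bounded_bilinear_over_lact:
  "bounded_bilinear_over scaleA scaleB scaleB lact"
  by (intro bounded_bilinear_over.intro bounded_bilinear_over_axioms.intro
      A.normed_space_over_axioms B.normed_space_over_axioms
      bounded_bilinear_lact lact_scaleA lact_scaleB)

lemma (in banach_bimodule_over) bounded_bilinear_over_ract:
  "bounded_bilinear_over scaleB scaleA scaleB ract"
  by (intro bounded_bilinear_over.intro bounded_bilinear_over_axioms.intro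
      A.normed_space_over_axioms B.normed_space_over_axioms
      bounded_bilinear_ract ract_scaleA ract_scaleB)

lemma (in banach_bimodule_over) left_centre_eq_bidual:
  assumes "bidual scaleA = (\<lambda>u. \<lambda>f\<in>dual scaleA. u (\<lambda>x. f (T x))) ` bidual scaleA"
    and "bounded_linear T" "\<And>c x. T (scaleA c x) = scaleA c (T x)"
    and "adjoint_weak_star_to_weak scaleA T"
  shows "left_centre scaleA scaleB lact = bidual scaleA"
  using bounded_bilinear_over.triple_adjoint_continuous[OF bounded_bilinear_over_lact assms]
  by (auto simp: left_centre_def)

lemma (in banach_bimodule_over) right_centre_eq_bidual:
  assumes "bidual scaleB = (\<lambda>u. \<lambda>f\<in>dual scaleB. u (\<lambda>x. f (T x))) ` bidual scaleB"
    and "bounded_linear T" "\<And>c x. T (scaleB c x) = scaleB c (T x)"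
    and "adjoint_weak_star_to_weak scaleB T"
  shows "right_centre scaleA scaleB ract = bidual scaleB"
  using bounded_bilinear_over.triple_adjoint_continuous[OF bounded_bilinear_over_ract assms]
  by (auto simp: right_centre_def)

theorem mainTheorem5:
  fixes scaleA :: "'k::real_normed_field \<Rightarrow> 'a::{real_normed_algebra,banach} \<Rightarrow> 'a"
    and scaleB :: "'k \<Rightarrow> 'b::banach \<Rightarrow> 'b"
    and lact :: "'a \<Rightarrow> 'b \<Rightarrow> 'b"
    and ract :: "'b \<Rightarrow> 'a \<Rightarrow> 'b"
  assumes "banach_bimodule_over scaleA scaleB lact ract"
  shows
    "((\<exists>a0. bidual scaleA = (\<lambda>a''. bidual_lact scaleA (*) a0 a'') ` bidual scaleA \<and>
            Rww_property scaleA (*) a0)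
        \<longrightarrow> left_centre scaleA scaleB lact = bidual scaleA) \<and>
     ((\<exists>a0. bidual scaleA = (\<lambda>a''. bidual_ract scaleA (*) a'' a0) ` bidual scaleA \<and>
            Lww_property scaleA (*) a0)
        \<longrightarrow> left_centre scaleA scaleB lact = bidual scaleA) \<and>
     ((\<exists>a0. bidual scaleB = (\<lambda>b''. bidual_lact scaleB lact a0 b'') ` bidual scaleB \<and>
            Rww_property scaleB lact a0)
        \<longrightarrow> right_centre scaleA scaleB ract = bidual scaleB) \<and>
     ((\<exists>a0. bidual scaleB = (\<lambda>b''. bidual_ract scaleB ract b'' a0) ` bidual scaleB \<and>
            Lww_property scaleB ract a0)
        \<longrightarrow> right_centre scaleA scaleB ract = bidual scaleB)"
proof -
  interpret banach_bimodule_over scaleA scaleB lact ract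
    by (rule assms)
  note unfold = bidual_lact_def bidual_ract_def dual_lact_def dual_ract_def
    Lww_property_adjoint Rww_property_adjoint
  show ?thesis
    unfolding unfold
  proof (intro conjI impI; elim exE conjE)
    fix a0 :: 'a
    note left = left_centre_eq_bidual and right = right_centre_eq_bidual
    show "left_centre scaleA scaleB lact = bidual scaleA"
      if "bidual scaleA = (\<lambda>a''. \<lambda>f\<in>dual scaleA. a'' (\<lambda>x. f (a0 * x))) ` bidual scaleA"
        "adjoint_weak_star_to_weak scaleA ((*) a0)"
      using left[OF that(1) bounded_linear_mult_right A.scale_mult_right that(2)] .
    show "left_centre scaleA scaleB lact = bidual scaleA"
      if "bidual scaleA = (\<lambda>a''. \<lambda>f\<in>dual scaleA. a'' (\<lambda>x. f (x * a0))) ` bidual scaleA"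
        "adjoint_weak_star_to_weak scaleA (\<lambda>x. x * a0)"
      using left[OF that(1) bounded_linear_mult_left A.scale_mult_left that(2)] .
    show "right_centre scaleA scaleB ract = bidual scaleB"
      if "bidual scaleB = (\<lambda>b''. \<lambda>f\<in>dual scaleB. b'' (\<lambda>x. f (lact a0 x))) ` bidual scaleB"
        "adjoint_weak_star_to_weak scaleB (lact a0)"
      using right[OF that(1) bounded_bilinear.bounded_linear_right[OF bounded_bilinear_lact]
          lact_scaleB that(2)] .
    show "right_centre scaleA scaleB ract = bidual scaleB"
      if "bidual scaleB = (\<lambda>b''. \<lambda>f\<in>dual scaleB. b'' (\<lambda>x. f (ract x a0))) ` bidual scaleB"
        "adjoint_weak_star_to_weak scaleB (\<lambda>x. ract x a0)"
      using right[OF that(1) bounded_bilinear.bounded_linear_left[OF bounded_bilinear_ract]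
          ract_scaleB that(2)] .
  qed
qed

end
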